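(* Let $G,H:\mathbb{R}^n\to\mathbb{R}^m$ be continuously differentiable, let $\mathcal{S}=\{x\in\mathbb{R}^n: G(x)\ge 0,\ H(x)\ge 0,\ G(x)^TH(x)=0\}$ be nonempty with $0\notin\mathcal{S}$, and let $\nu>0$ be fixed. For $\sigma>0$, let $x_\sigma$ be a global minimizer of the problem $$(R_{\nu,\sigma})\quad \min\ \Phi(x)\quad\text{s.t.}\quad G(x)\ge0,\ H(x)\ge0,\ G(x)^TH(x)\le\sigma .$$ Let $x^*$ be an arbitrary accumulation point of $\{x_\sigma\}$ as $\sigma\downarrow0$. Then $x^*$ is a global minimizer of the problem $(R_\nu)$: $\min_{x\in\mathcal{S}}\Phi(x)$; i.e., $X^*\subseteq X_\nu^*$.
   Context: Inequalities between vectors are componentwise. $\Phi(x)=\sum_{i=1}^n\min\{1,|x_i|/\nu\}$. $X_\nu^*$ is the set of global minimizers of $(R_\nu)$, $X_\sigma$ is the set of global minimizers of $(R_{\nu,\sigma})$, and $$X^*=\{x^*\in\mathbb{R}^n:\ \exists\,\sigma_k\to0\text{ with }\sigma_k>0\text{ and }x_{\sigma_k}\in X_{\sigma_k}\text{ such that }x_{\sigma_k}\to x^*\}.$$ *)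

theory Defs
  imports "HOL-Analysis.Analysis"
begin

text \<open>
  The order on \<open>real ^ 'm\<close> is the componentwise one, so \<open>0 \<le> G x\<close> reads
  \<open>G\<^sub>i(x) \<ge> 0\<close> for all \<open>i\<close>; \<open>G x \<bullet> H x\<close> is the scalar product of \<open>G(x)\<close> and \<open>H(x)\<close>.
\<close>

text \<open>The derivative is continuous with respect to the operator norm.\<close>

definition continuously_differentiable ::
  "('a::real_normed_vector \<Rightarrow> 'b::real_normed_vector) \<Rightarrow> bool" where
  "continuously_differentiable f \<longleftrightarrow>
     (\<exists>f' :: 'a \<Rightarrow> 'a \<Rightarrow>\<^sub>L 'b.
        (\<forall>x. (f has_derivative blinfun_apply (f' x)) (at x)) \<and> continuous_on UNIV f')"

definition global_minimizers :: "('a \<Rightarrow> real) \<Rightarrow> 'a set \<Rightarrow> 'a set" where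
  "global_minimizers f S = {x. is_arg_min f (\<lambda>y. y \<in> S) x}"

definition Phi :: "real \<Rightarrow> real ^ 'n \<Rightarrow> real" where
  "Phi \<nu> x = (\<Sum>i\<in>UNIV. min 1 (\<bar>x $ i\<bar> / \<nu>))"

definition compl_set :: "(real ^ 'n \<Rightarrow> real ^ 'm) \<Rightarrow> (real ^ 'n \<Rightarrow> real ^ 'm) \<Rightarrow> (real ^ 'n) set" where
  "compl_set G H = {x. 0 \<le> G x \<and> 0 \<le> H x \<and> G x \<bullet> H x = 0}"

definition relaxed_set ::
  "(real ^ 'n \<Rightarrow> real ^ 'm) \<Rightarrow> (real ^ 'n \<Rightarrow> real ^ 'm) \<Rightarrow> real \<Rightarrow> (real ^ 'n) set" where
  "relaxed_set G H \<sigma> = {x. 0 \<le> G x \<and> 0 \<le> H x \<and> G x \<bullet> H x \<le> \<sigma>}"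

definition X_nu ::
  "(real ^ 'n \<Rightarrow> real ^ 'm) \<Rightarrow> (real ^ 'n \<Rightarrow> real ^ 'm) \<Rightarrow> real \<Rightarrow> (real ^ 'n) set" where
  "X_nu G H \<nu> = global_minimizers (Phi \<nu>) (compl_set G H)"

definition X_sigma ::
  "(real ^ 'n \<Rightarrow> real ^ 'm) \<Rightarrow> (real ^ 'n \<Rightarrow> real ^ 'm) \<Rightarrow> real \<Rightarrow> real \<Rightarrow> (real ^ 'n) set" where
  "X_sigma G H \<nu> \<sigma> = global_minimizers (Phi \<nu>) (relaxed_set G H \<sigma>)"

text \<open>
  The relaxed problem need not have a solution for every \<open>\<sigma>\<close> (\<open>Phi\<close> is bounded), so
  \<open>X_sigma\<close> may be empty; only the parameters along the sequence matter here.
\<close>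

definition X_star ::
  "(real ^ 'n \<Rightarrow> real ^ 'm) \<Rightarrow> (real ^ 'n \<Rightarrow> real ^ 'm) \<Rightarrow> real \<Rightarrow> (real ^ 'n) set" where
  "X_star G H \<nu> = {z. \<exists>(\<sigma> :: nat \<Rightarrow> real) x.
     (\<forall>k. 0 < \<sigma> k) \<and> \<sigma> \<longlonglongrightarrow> 0 \<and> (\<forall>k. x k \<in> X_sigma G H \<nu> (\<sigma> k)) \<and> x \<longlonglongrightarrow> z}"

definition accumulation_points_at_0 :: "(real \<Rightarrow> 'a::topological_space) \<Rightarrow> 'a set" where
  "accumulation_points_at_0 x = {z. \<exists>\<sigma> :: nat \<Rightarrow> real.
     (\<forall>k. 0 < \<sigma> k) \<and> \<sigma> \<longlonglongrightarrow> 0 \<and> (\<lambda>k. x (\<sigma> k)) \<longlonglongrightarrow> z}"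

end

theory Submission
  imports Defs
begin

text \<open>
  Every point of \<open>compl_set G H\<close> is feasible for every relaxed problem, so a relaxed minimizer
  never has a larger value of \<open>Phi \<nu>\<close> than any point of \<open>compl_set G H\<close>. Since \<open>Phi \<nu>\<close> is
  continuous, this inequality passes to a limit \<open>z\<close> of relaxed minimizers as \<open>\<sigma>\<close> tends to \<open>0\<close>.
  It remains to see that \<open>z\<close> is itself feasible: the sign conditions are closed, and
  \<open>G z \<bullet> H z \<le> 0\<close> as the limit of \<open>G (x k) \<bullet> H (x k) \<le> \<sigma> k\<close>, whereas the scalar product of
  nonnegative vectors is nonnegative. This is \<open>compl_set_limit\<close>, and
  \<open>X_star_subset_X_nu\<close> combines it with the comparison of values. The accumulation points of a
  selection \<open>x \<sigma> \<in> X_sigma G H \<nu> \<sigma>\<close> all belong to \<open>X_star G H \<nu>\<close>, so they are covered as well.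
\<close>

lemma inner_nonneg_vec:
  fixes u v :: "real ^ 'm"
  assumes "0 \<le> u" and "0 \<le> v"
  shows "0 \<le> u \<bullet> v"
  using assms by (auto simp: inner_vec_def less_eq_vec_def intro!: sum_nonneg)

lemma tendsto_nonneg_vec:
  fixes u :: "nat \<Rightarrow> real ^ 'm"
  assumes "u \<longlonglongrightarrow> a" and "\<And>k. 0 \<le> u k"
  shows "0 \<le> a"
proof -
  have "0 \<le> a $ i" for i
    using assms(2)
    by (intro LIMSEQ_le_const[OF tendsto_vec_nth[OF assms(1)]]) (auto simp: less_eq_vec_def)
  then show ?thesis
    by (simp add: less_eq_vec_def)
qed

lemma isCont_Phi:
  assumes "\<nu> > 0"
  shows "isCont (Phi \<nu>) z"
  unfolding Phi_def using assms by (intro continuous_intros) auto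

lemma continuously_differentiable_imp_isCont:
  "continuously_differentiable f \<Longrightarrow> isCont f z"
  by (auto simp: continuously_differentiable_def intro: has_derivative_continuous)

lemma compl_set_subset_relaxed_set: "0 \<le> \<sigma> \<Longrightarrow> compl_set G H \<subseteq> relaxed_set G H \<sigma>"
  by (auto simp: compl_set_def relaxed_set_def)

text \<open>
  In the limit the relaxation only leaves the inequality \<open>G z \<bullet> H z \<le> 0\<close>; complementarity
  follows because the sign conditions force the opposite inequality.
\<close>

lemma compl_set_limit:
  fixes G H :: "real ^ 'n \<Rightarrow> real ^ 'm"
  assumes G: "isCont G z" and H: "isCont H z"
    and \<sigma>: "\<sigma> \<longlonglongrightarrow> 0" and x: "x \<longlonglongrightarrow> z" and feas: "\<And>k. x k \<in> relaxed_set G H (\<sigma> k)"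
  shows "z \<in> compl_set G H"
proof -
  have limG: "(\<lambda>k. G (x k)) \<longlonglongrightarrow> G z" and limH: "(\<lambda>k. H (x k)) \<longlonglongrightarrow> H z"
    using G H x by (auto intro: isCont_tendsto_compose)
  have "0 \<le> G z" "0 \<le> H z"
    using feas by (auto simp: relaxed_set_def intro: tendsto_nonneg_vec limG limH)
  moreover have "G z \<bullet> H z \<le> 0"
    using feas by (intro LIMSEQ_le[OF tendsto_inner[OF limG limH] \<sigma>]) (auto simp: relaxed_set_def)
  ultimately show ?thesis
    using inner_nonneg_vec[of "G z" "H z"] by (simp add: compl_set_def)
qed

text \<open>
  A competitor \<open>y \<in> compl_set G H\<close> can be kept fixed along the whole sequence, because it is
  feasible for every \<open>\<sigma> k\<close>. Hence only the left side of \<open>Phi \<nu> (x k) \<le> Phi \<nu> y\<close> varies.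
\<close>

lemma X_star_subset_X_nu:
  fixes G H :: "real ^ 'n \<Rightarrow> real ^ 'm"
  assumes "\<And>z. isCont G z" and "\<And>z. isCont H z" and "\<nu> > 0"
  shows "X_star G H \<nu> \<subseteq> X_nu G H \<nu>"
proof
  fix z
  assume "z \<in> X_star G H \<nu>"
  then obtain \<sigma> x where \<sigma>: "\<And>k. 0 < \<sigma> k" "\<sigma> \<longlonglongrightarrow> 0"
    and min: "\<And>k. x k \<in> X_sigma G H \<nu> (\<sigma> k)" and x: "x \<longlonglongrightarrow> z"
    by (auto simp: X_star_def)
  have feas: "x k \<in> relaxed_set G H (\<sigma> k)" for k
    using min[of k] by (simp add: X_sigma_def global_minimizers_def is_arg_min_def)
  have "Phi \<nu> z \<le> Phi \<nu> y" if "y \<in> compl_set G H" for y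
  proof (rule LIMSEQ_le_const2)
    show "(\<lambda>k. Phi \<nu> (x k)) \<longlonglongrightarrow> Phi \<nu> z"
      using isCont_Phi[OF assms(3)] x by (rule isCont_tendsto_compose)
    have "Phi \<nu> (x k) \<le> Phi \<nu> y" for k
      using min[of k] that \<sigma>(1)[of k] compl_set_subset_relaxed_set[of "\<sigma> k" G H]
      by (auto simp: X_sigma_def global_minimizers_def is_arg_min_linorder)
    then show "\<exists>N. \<forall>k\<ge>N. Phi \<nu> (x k) \<le> Phi \<nu> y"
      by blast
  qed
  moreover have "z \<in> compl_set G H"
    using assms(1,2) \<sigma>(2) x feas by (rule compl_set_limit)
  ultimately show "z \<in> X_nu G H \<nu>"
    by (simp add: X_nu_def global_minimizers_def is_arg_min_linorder)
qed

lemma accumulation_points_at_0_subset_X_star: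
  assumes "\<And>\<sigma>. 0 < \<sigma> \<Longrightarrow> x \<sigma> \<in> X_sigma G H \<nu> \<sigma>"
  shows "accumulation_points_at_0 x \<subseteq> X_star G H \<nu>"
proof
  fix z
  assume "z \<in> accumulation_points_at_0 x"
  then obtain \<sigma> where "\<forall>k. 0 < \<sigma> k" "\<sigma> \<longlonglongrightarrow> 0" "(\<lambda>k. x (\<sigma> k)) \<longlonglongrightarrow> z"
    by (auto simp: accumulation_points_at_0_def)
  with assms show "z \<in> X_star G H \<nu>"
    unfolding X_star_def by (intro CollectI exI[of _ \<sigma>] exI[of _ "\<lambda>k. x (\<sigma> k)"]) simp
qed

theorem proposition1:
  fixes G H :: "real ^ 'n \<Rightarrow> real ^ 'm" and \<nu> :: real
  assumes "continuously_differentiable G" and "continuously_differentiable H"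
    and "compl_set G H \<noteq> {}" and "0 \<notin> compl_set G H"
    and "\<nu> > 0"
  shows "(\<forall>x. (\<forall>\<sigma>>0. x \<sigma> \<in> X_sigma G H \<nu> \<sigma>) \<longrightarrow>
              (\<forall>xstar\<in>accumulation_points_at_0 x. xstar \<in> X_nu G H \<nu>))
         \<and> X_star G H \<nu> \<subseteq> X_nu G H \<nu>"
proof -
  have "X_star G H \<nu> \<subseteq> X_nu G H \<nu>"
    using assms(1,2,5) by (intro X_star_subset_X_nu continuously_differentiable_imp_isCont)
  then show ?thesis
    using accumulation_points_at_0_subset_X_star[of _ G H \<nu>] by blast
qed

end
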